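(* Let $k_1,k_2,T_c>0$, $\rho_L\le\rho_U$, $0<\gamma<1$, and let $$A_d(\rho)=\begin{bmatrix}1&-T_c&0\\ T_ck_1k_2\rho&1-T_ck_2&T_ck_2(1-\rho)\\ 0&1&0\end{bmatrix},\qquad B=\begin{bmatrix}0\\1\\0\end{bmatrix}.$$ Suppose $P\in\mathbb{R}^{3\times3}$ is symmetric positive definite and $A_d(\rho)^TPA_d(\rho)\preceq\gamma^2P$ for all $\rho\in[\rho_L,\rho_U]$. Let $(\rho_k)$ be a sequence in $[\rho_L,\rho_U]$, let $(g_k)$ be a real sequence, and let $(\xi_k)$ in $\mathbb{R}^3$ satisfy $\xi_{k+1}=A_d(\rho_k)\xi_k+Bg_k$ for $k\ge k_0$. Then for all $k\ge k_0$, $$\|\xi_k\|_P\le\gamma^{k-k_0}\|\xi_{k_0}\|_P+\|B\|_P\sum_{j=k_0}^{k-1}\gamma^{k-1-j}|g_j|.$$ If moreover $|g_k|\le\bar g$ for all $k$, then $$\limsup_{k\to\infty}\|\xi_k\|_2\le\frac{\sqrt{B^TPB}}{\sqrt{\lambda_{\min}(P)}\,(1-\gamma)}\,\bar g.$$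
   Context: $\|x\|_P=\sqrt{x^TPx}$ for $x\in\mathbb{R}^3$ (in particular $\|B\|_P=\sqrt{B^TPB}$), $\preceq$ is the Loewner order on real symmetric matrices, and $\lambda_{\min}(P)$ is the smallest eigenvalue of $P$. *)

theory Defs
  imports "HOL-Analysis.Analysis"
begin

definition symmetric_matrix :: "real ^ 'n ^ 'n \<Rightarrow> bool" where
  "symmetric_matrix P \<longleftrightarrow> transpose P = P"

definition positive_definite :: "real ^ 'n ^ 'n \<Rightarrow> bool" where
  "positive_definite P \<longleftrightarrow> (\<forall>x. x \<noteq> 0 \<longrightarrow> 0 < x \<bullet> (P *v x))"

definition positive_semidefinite :: "real ^ 'n ^ 'n \<Rightarrow> bool" where
  "positive_semidefinite P \<longleftrightarrow> (\<forall>x. 0 \<le> x \<bullet> (P *v x))"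

definition loewner_le :: "real ^ 'n ^ 'n \<Rightarrow> real ^ 'n ^ 'n \<Rightarrow> bool"  (infix "\<preceq>\<^sub>L" 50) where
  "X \<preceq>\<^sub>L Y \<longleftrightarrow> symmetric_matrix X \<and> symmetric_matrix Y \<and> positive_semidefinite (Y - X)"

definition weighted_norm :: "real ^ 'n ^ 'n \<Rightarrow> real ^ 'n \<Rightarrow> real" where
  "weighted_norm P x = sqrt (x \<bullet> (P *v x))"

definition eigenvalues :: "real ^ 'n ^ 'n \<Rightarrow> real set" where
  "eigenvalues P = {l. \<exists>v. v \<noteq> 0 \<and> P *v v = l *\<^sub>R v}"

(* Used only for symmetric P, where the real eigenvalues form a finite nonempty set. *)
definition lambda_min :: "real ^ 'n ^ 'n \<Rightarrow> real" where
  "lambda_min P = Min (eigenvalues P)"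

definition A_d :: "real \<Rightarrow> real \<Rightarrow> real \<Rightarrow> real \<Rightarrow> real ^ 3 ^ 3" where
  "A_d k1 k2 Tc \<rho> = vector
     [vector [1,                -Tc,         0],
      vector [Tc * k1 * k2 * \<rho>, 1 - Tc * k2, Tc * k2 * (1 - \<rho>)],
      vector [0,                1,           0]]"

definition B_d :: "real ^ 3" where
  "B_d = vector [0, 1, 0]"

end

theory Submission
  imports Defs
begin

text \<open>
  The matrix inequality says that every \<open>A_d k1 k2 Tc r\<close> contracts the norm given by \<open>P\<close> by the
  factor \<open>\<gamma>\<close>, so the triangle inequality turns the dynamics into the scalar recurrence
  \<open>w (Suc k) \<le> \<gamma> * w k + b * \<bar>g k\<bar>\<close>. The Rayleigh bound \<open>\<lambda>\<^sub>m\<^sub>i\<^sub>n \<parallel>x\<parallel>\<^sup>2 \<le> x \<bullet> P x\<close> transfers the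
  resulting estimate to the Euclidean norm.
\<close>

section \<open>Quadratic forms of symmetric matrices\<close>

lemma symmetric_matrix_inner:
  assumes "symmetric_matrix Q"
  shows "x \<bullet> (Q *v y) = y \<bullet> (Q *v x)"
  using assms by (metis dot_lmul_matrix inner_commute symmetric_matrix_def
      transpose_matrix_vector)

lemma positive_definite_imp_semidefinite:
  "positive_definite P \<Longrightarrow> positive_semidefinite P"
  unfolding positive_definite_def positive_semidefinite_def
  by (metis inner_zero_left less_eq_real_def)

lemma quadratic_form_add:
  assumes "symmetric_matrix Q"
  shows "(x + y) \<bullet> (Q *v (x + y)) = x \<bullet> (Q *v x) + 2 * (x \<bullet> (Q *v y)) + y \<bullet> (Q *v y)"
  using symmetric_matrix_inner[OF assms, of x y]
  by (simp add: matrix_vector_right_distrib inner_add_left inner_add_right)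

text \<open>For \<open>c > 0\<close> evaluate at the vertex \<open>t = - b / c\<close>. For
  \<open>c = 0\<close> the expression is affine in \<open>t\<close>, so staying nonnegative forces
  slope zero.\<close>

lemma nonneg_quadratic_discriminant:
  fixes a b c :: real
  assumes nonneg: "\<And>t. 0 \<le> a + 2 * (t * b) + t\<^sup>2 * c" and "0 \<le> c"
  shows "b\<^sup>2 \<le> a * c"
proof (cases "c = 0")
  case True
  have "b = 0"
  proof (rule ccontr)
    assume "b \<noteq> 0"
    \<comment> \<open>This choice of \<open>t\<close> gives the affine function
      \<open>a + 2 * (t * b)\<close> the value -1.\<close>
    then show False
      using nonneg[of "- (a + 1) / (2 * b)"] nonneg[of 0] True by (simp add: field_simps)
  qed
  then show ?thesis using True by simp
next
  case False
  with \<open>0 \<le> c\<close> have "c > 0" by simp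
  then show ?thesis
    using nonneg[of "- b / c"] by (simp add: field_simps power2_eq_square)
qed

text \<open>The form at \<open>x + t *\<^sub>R y\<close> is a nonnegative quadratic in
  \<open>t\<close>. Assuming only semidefiniteness lets the result apply to singular matrices, as
  \<open>psd_kernel\<close> requires.\<close>

lemma psd_Cauchy_Schwarz:
  assumes "symmetric_matrix Q" "positive_semidefinite Q"
  shows "(x \<bullet> (Q *v y))\<^sup>2 \<le> (x \<bullet> (Q *v x)) * (y \<bullet> (Q *v y))"
proof (rule nonneg_quadratic_discriminant)
  fix t :: real
  have "0 \<le> (x + t *\<^sub>R y) \<bullet> (Q *v (x + t *\<^sub>R y))"
    using assms(2) unfolding positive_semidefinite_def by blast
  then show "0 \<le> x \<bullet> (Q *v x) + 2 * (t * (x \<bullet> (Q *v y))) + t\<^sup>2 * (y \<bullet> (Q *v y))"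
    unfolding quadratic_form_add[OF assms(1)]
    by (simp add: matrix_vector_mult_scaleR power2_eq_square mult.assoc)
  show "0 \<le> y \<bullet> (Q *v y)"
    using assms(2) unfolding positive_semidefinite_def by blast
qed

text \<open>Cauchy-Schwarz against the vector \<open>Q *v v\<close> itself bounds the fourth power
  of its norm by zero.\<close>

lemma psd_kernel:
  assumes "symmetric_matrix Q" "positive_semidefinite Q" "v \<bullet> (Q *v v) = 0"
  shows "Q *v v = 0"
  using psd_Cauchy_Schwarz[OF assms(1,2), of "Q *v v" v] assms(3) by simp

section \<open>The norm weighted by a matrix\<close>

lemma weighted_norm_nonneg:
  "positive_semidefinite P \<Longrightarrow> 0 \<le> weighted_norm P x"
  by (simp add: weighted_norm_def positive_semidefinite_def)

lemma weighted_norm_power2: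
  "positive_semidefinite P \<Longrightarrow> (weighted_norm P x)\<^sup>2 = x \<bullet> (P *v x)"
  by (simp add: weighted_norm_def positive_semidefinite_def)

lemma weighted_norm_scaleR:
  "weighted_norm P (c *\<^sub>R x) = \<bar>c\<bar> * weighted_norm P x"
  by (simp add: weighted_norm_def matrix_vector_mult_scaleR real_sqrt_mult
      flip: mult.assoc)

text \<open>After squaring, the two sides differ only in the cross term, which Cauchy-Schwarz
  controls.\<close>

lemma weighted_norm_triangle:
  assumes sym: "symmetric_matrix P" and psd: "positive_semidefinite P"
  shows "weighted_norm P (x + y) \<le> weighted_norm P x + weighted_norm P y"
proof (rule power2_le_imp_le)
  have "(x \<bullet> (P *v y))\<^sup>2 \<le> (weighted_norm P x * weighted_norm P y)\<^sup>2"
    using psd_Cauchy_Schwarz[OF assms, of x y]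
    by (simp add: power_mult_distrib weighted_norm_power2[OF psd])
  then have "x \<bullet> (P *v y) \<le> weighted_norm P x * weighted_norm P y"
    by (rule power2_le_imp_le) (simp add: weighted_norm_nonneg[OF psd])
  then show "(weighted_norm P (x + y))\<^sup>2 \<le> (weighted_norm P x + weighted_norm P y)\<^sup>2"
    by (simp add: power2_sum weighted_norm_power2[OF psd] quadratic_form_add[OF sym])
qed (simp add: weighted_norm_nonneg[OF psd])

text \<open>Moving \<open>transpose A\<close> across the inner product turns the form of
  \<open>transpose A ** P ** A\<close> at \<open>x\<close> into the form of \<open>P\<close> at
  \<open>A *v x\<close>; square roots then give the factor \<gamma>.\<close>

lemma weighted_norm_contraction:
  assumes "0 \<le> \<gamma>" and le: "transpose A ** P ** A \<preceq>\<^sub>L \<gamma>\<^sup>2 *\<^sub>R P"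
  shows "weighted_norm P (A *v x) \<le> \<gamma> * weighted_norm P x"
proof -
  have "(transpose A ** P ** A) *v x = transpose A *v (P *v (A *v x))"
    by (simp add: matrix_vector_mul_assoc matrix_mul_assoc)
  then have "x \<bullet> ((transpose A ** P ** A) *v x) = (A *v x) \<bullet> (P *v (A *v x))"
    by (metis dot_lmul_matrix transpose_matrix_vector inner_commute)
  moreover have "0 \<le> x \<bullet> ((\<gamma>\<^sup>2 *\<^sub>R P - transpose A ** P ** A) *v x)"
    using le unfolding loewner_le_def positive_semidefinite_def by blast
  ultimately have "(A *v x) \<bullet> (P *v (A *v x)) \<le> \<gamma>\<^sup>2 * (x \<bullet> (P *v x))"
    by (simp add: matrix_vector_mult_diff_rdistrib inner_diff_right
        scaleR_matrix_vector_assoc[symmetric])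
  then show ?thesis
    using assms(1) real_sqrt_le_mono by (fastforce simp: weighted_norm_def real_sqrt_mult)
qed

section \<open>The smallest eigenvalue and the Rayleigh bound\<close>

text \<open>Choosing one eigenvector per eigenvalue gives an orthogonal, hence independent, family.
  Finiteness is what gives \<open>Min\<close> in \<open>lambda_min\<close> its meaning.\<close>

lemma finite_eigenvalues:
  assumes sym: "symmetric_matrix (P :: real ^ 'n ^ 'n)"
  shows "finite (eigenvalues P)"
proof -
  have "\<forall>l\<in>eigenvalues P. \<exists>v. v \<noteq> 0 \<and> P *v v = l *\<^sub>R v"
    unfolding eigenvalues_def by simp
  then obtain f where f: "\<And>l. l \<in> eigenvalues P \<Longrightarrow> f l \<noteq> 0 \<and> P *v f l = l *\<^sub>R f l"
    by metis
  have orth: "f l \<bullet> f m = 0"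
    if "l \<in> eigenvalues P" "m \<in> eigenvalues P" "l \<noteq> m" for l m
    using symmetric_matrix_inner[OF sym, of "f l" "f m"] f[OF that(1)] f[OF that(2)] that(3)
    by (simp add: inner_commute)
  \<comment> \<open>A vector shared by two distinct eigenvalues would be orthogonal to itself, hence
    zero.\<close>
  have "inj_on f (eigenvalues P)"
    by (rule inj_onI) (metis f orth inner_eq_zero_iff)
  moreover have "pairwise orthogonal (f ` eigenvalues P)"
    unfolding pairwise_def orthogonal_def using orth by auto
  then have "independent (f ` eigenvalues P)"
    by (rule pairwise_orthogonal_independent) (use f in force)
  then have "finite (f ` eigenvalues P)"
    by (rule independent_imp_finite)
  ultimately show ?thesis by (simp add: finite_image_iff)
qed

text \<open>The form attains its minimum \<open>m\<close> on the compact unit sphere, and the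
  minimizer turns out to be an eigenvector for \<open>m\<close>.\<close>

lemma Rayleigh_minimum:
  assumes sym: "symmetric_matrix (P :: real ^ 'n ^ 'n)"
  obtains m where "m \<in> eigenvalues P" "\<And>x. m * (norm x)\<^sup>2 \<le> x \<bullet> (P *v x)"
proof -
  have "continuous_on (sphere 0 1) (\<lambda>x. x \<bullet> (P *v x))"
    by (intro continuous_intros matrix_vector_mult_linear_continuous_on)
  moreover have "sphere (0 :: real ^ 'n) 1 \<noteq> {}" by simp
  ultimately obtain v where v: "norm v = 1"
    and min: "\<And>x. norm x = 1 \<Longrightarrow> v \<bullet> (P *v v) \<le> x \<bullet> (P *v x)"
    using continuous_attains_inf[of "sphere (0 :: real ^ 'n) 1" "\<lambda>x. x \<bullet> (P *v x)"]
    by auto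
  define m where "m = v \<bullet> (P *v v)"
  have bound: "m * (norm x)\<^sup>2 \<le> x \<bullet> (P *v x)" for x
  proof (cases "x = 0")
    case False
    \<comment> \<open>Normalizing \<open>x\<close> reduces to the unit sphere, since the form is
      homogeneous of degree two.\<close>
    then have "m \<le> ((1 / norm x) *\<^sub>R x) \<bullet> (P *v ((1 / norm x) *\<^sub>R x))"
      unfolding m_def by (intro min) simp
    with False show ?thesis
      by (simp add: matrix_vector_mult_scaleR field_simps power2_eq_square)
  qed simp
  \<comment> \<open>Shifting by \<open>m\<close> makes the form nonnegative with a zero at
    \<open>v\<close>, so \<open>psd_kernel\<close> replaces a Lagrange multiplier argument.\<close>
  define Q where "Q = P - m *\<^sub>R mat 1"
  have Q: "Q *v x = P *v x - m *\<^sub>R x" for x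
    unfolding Q_def by (simp add: matrix_vector_mult_diff_rdistrib
        scaleR_matrix_vector_assoc[symmetric])
  have "symmetric_matrix Q"
    using sym unfolding Q_def symmetric_matrix_def
    by (simp add: transpose_def vec_eq_iff mat_def)
  moreover have "positive_semidefinite Q"
    unfolding positive_semidefinite_def Q
    using bound by (simp add: inner_diff_right power2_norm_eq_inner)
  moreover have "v \<bullet> (Q *v v) = 0"
    using v by (simp add: Q inner_diff_right m_def norm_eq_1)
  ultimately have "Q *v v = 0" by (rule psd_kernel)
  then have "P *v v = m *\<^sub>R v" by (simp add: Q)
  moreover have "v \<noteq> 0" using v by auto
  ultimately have "m \<in> eigenvalues P" unfolding eigenvalues_def by blast
  then show ?thesis using bound that by blast
qed

lemma lambda_min_in_eigenvalues:
  "symmetric_matrix P \<Longrightarrow> lambda_min P \<in> eigenvalues P"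
  unfolding lambda_min_def by (metis Min_in finite_eigenvalues Rayleigh_minimum empty_iff)

lemma lambda_min_le_quadratic_form:
  assumes sym: "symmetric_matrix P"
  shows "lambda_min P * (norm x)\<^sup>2 \<le> x \<bullet> (P *v x)"
proof -
  obtain m where m: "m \<in> eigenvalues P" "\<And>x. m * (norm x)\<^sup>2 \<le> x \<bullet> (P *v x)"
    using Rayleigh_minimum[OF sym] by blast
  have "lambda_min P \<le> m"
    unfolding lambda_min_def using finite_eigenvalues[OF sym] m(1) by (rule Min_le)
  then have "lambda_min P * (norm x)\<^sup>2 \<le> m * (norm x)\<^sup>2" by (simp add: mult_right_mono)
  then show ?thesis using m(2) order_trans by blast
qed

text \<open>Positive definiteness is tested on an eigenvector for
  \<open>lambda_min P\<close>.\<close>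

lemma lambda_min_pos:
  assumes "symmetric_matrix P" "positive_definite P"
  shows "0 < lambda_min P"
proof -
  obtain v where v: "v \<noteq> 0" "P *v v = lambda_min P *\<^sub>R v"
    using lambda_min_in_eigenvalues[OF assms(1)] unfolding eigenvalues_def by blast
  then have "0 < lambda_min P * (v \<bullet> v)"
    using assms(2) unfolding positive_definite_def by (metis inner_scaleR_right)
  then show ?thesis using v(1) zero_less_mult_pos2[of "lambda_min P" "v \<bullet> v"] by simp
qed

lemma norm_le_weighted_norm:
  assumes "symmetric_matrix P" "positive_definite P"
  shows "norm x \<le> weighted_norm P x / sqrt (lambda_min P)"
proof -
  have "sqrt (lambda_min P * (norm x)\<^sup>2) \<le> weighted_norm P x"
    unfolding weighted_norm_def
    by (rule real_sqrt_le_mono, rule lambda_min_le_quadratic_form[OF assms(1)])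
  then show ?thesis
    using lambda_min_pos[OF assms] by (simp add: real_sqrt_mult field_simps)
qed

section \<open>Scalar recurrences and geometric sums\<close>

lemma linear_recurrence_convolution_bound:
  fixes w h :: "nat \<Rightarrow> real"
  assumes "0 \<le> \<gamma>" and step: "\<And>k. k0 \<le> k \<Longrightarrow> w (Suc k) \<le> \<gamma> * w k + b * h k"
    and "k0 \<le> k"
  shows "w k \<le> \<gamma> ^ (k - k0) * w k0 + b * (\<Sum>j=k0..<k. \<gamma> ^ (k - 1 - j) * h j)"
  using \<open>k0 \<le> k\<close>
proof (induction k rule: dec_induct)
  case (step n)
  have "\<gamma> * (\<Sum>j=k0..<n. \<gamma> ^ (n - 1 - j) * h j) = (\<Sum>j=k0..<n. \<gamma> ^ (n - j) * h j)"
    unfolding sum_distrib_left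
  proof (rule sum.cong)
    fix j assume "j \<in> {k0..<n}"
    \<comment> \<open>Subtraction on naturals truncates; \<open>j < n\<close> ensures that the
      factor \<gamma> raises the exponent by exactly one.\<close>
    then have "n - j = Suc (n - 1 - j)" by auto
    then show "\<gamma> * (\<gamma> ^ (n - 1 - j) * h j) = \<gamma> ^ (n - j) * h j"
      by (simp add: mult.assoc)
  qed simp
  then have sum: "(\<Sum>j=k0..<Suc n. \<gamma> ^ (Suc n - 1 - j) * h j)
      = \<gamma> * (\<Sum>j=k0..<n. \<gamma> ^ (n - 1 - j) * h j) + h n"
    using step.hyps by simp
  have "w (Suc n) \<le> \<gamma> * w n + b * h n" using assms(2) step.hyps by simp
  also have "\<dots> \<le> \<gamma> * (\<gamma> ^ (n - k0) * w k0
      + b * (\<Sum>j=k0..<n. \<gamma> ^ (n - 1 - j) * h j)) + b * h n"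
    using step.IH assms(1) by (simp add: mult_left_mono)
  also have "\<dots> = \<gamma> ^ (Suc n - k0) * w k0
      + b * (\<Sum>j=k0..<Suc n. \<gamma> ^ (Suc n - 1 - j) * h j)"
    unfolding sum using step.hyps by (simp add: Suc_diff_le algebra_simps)
  finally show ?case .
qed simp

lemma geometric_convolution_bound:
  fixes h :: "nat \<Rightarrow> real"
  assumes "0 \<le> \<gamma>" "\<gamma> < 1" and h: "\<And>j. k0 \<le> j \<Longrightarrow> h j \<le> G" and "0 \<le> G"
  shows "(\<Sum>j=k0..<k. \<gamma> ^ (k - 1 - j) * h j) \<le> G / (1 - \<gamma>)"
proof -
  have "(\<Sum>j=k0..<k. \<gamma> ^ (k - 1 - j) * h j) \<le> (\<Sum>j=k0..<k. \<gamma> ^ (k - 1 - j) * G)"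
    using assms by (intro sum_mono mult_left_mono) auto
  \<comment> \<open>The added terms with \<open>j < k0\<close> are nonnegative; starting at 0
    permits reversing the order of summation.\<close>
  also have "\<dots> \<le> (\<Sum>j<k. \<gamma> ^ (k - Suc j) * G)"
    using assms by (simp, intro sum_mono2) auto
  also have "\<dots> = (\<Sum>i<k. \<gamma> ^ i * G)"
    by (rule sum.nat_diff_reindex)
  also have "\<dots> = (\<Sum>i<k. \<gamma> ^ i) * G"
    by (simp add: sum_distrib_right)
  also have "\<dots> \<le> (1 / (1 - \<gamma>)) * G"
  proof (rule mult_right_mono[OF _ \<open>0 \<le> G\<close>])
    have "(\<Sum>i<k. \<gamma> ^ i) = (1 - \<gamma> ^ k) / (1 - \<gamma>)"
      using assms by (simp add: sum_gp_strict)
    also have "\<dots> \<le> 1 / (1 - \<gamma>)" using assms by (simp add: divide_right_mono)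
    finally show "(\<Sum>i<k. \<gamma> ^ i) \<le> 1 / (1 - \<gamma>)" .
  qed
  finally show ?thesis by simp
qed

lemma limsup_le_geometric_offset:
  fixes f :: "nat \<Rightarrow> real"
  assumes "0 \<le> \<gamma>" "\<gamma> < 1" and le: "\<And>k. k0 \<le> k \<Longrightarrow> f k \<le> \<gamma> ^ (k - k0) * a + c"
  shows "limsup (\<lambda>k. ereal (f k)) \<le> ereal c"
proof -
  have "(\<lambda>k. \<gamma> ^ (k - k0)) \<longlonglongrightarrow> 0"
    using LIMSEQ_realpow_zero[OF assms(1,2)]
    \<comment> \<open>Shifting the index by \<open>k0\<close> removes the truncated subtraction and
      leaves the plain powers of \<gamma>.\<close>
    by (subst LIMSEQ_offset[of _ k0]) simp_all
  then have "(\<lambda>k. \<gamma> ^ (k - k0) * a + c) \<longlonglongrightarrow> 0 * a + c"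
    by (intro tendsto_intros)
  then have "limsup (\<lambda>k. ereal (\<gamma> ^ (k - k0) * a + c)) = ereal c"
    by (intro lim_imp_Limsup) simp_all
  moreover have "limsup (\<lambda>k. ereal (f k)) \<le> limsup (\<lambda>k. ereal (\<gamma> ^ (k - k0) * a + c))"
    using le by (intro Limsup_mono) (auto simp: eventually_sequentially)
  ultimately show ?thesis by simp
qed

theorem mainTheorem4:
  fixes k1 k2 Tc \<rho>L \<rho>U \<gamma> :: real
    and P :: "real ^ 3 ^ 3"
    and \<rho> g :: "nat \<Rightarrow> real"
    and \<xi> :: "nat \<Rightarrow> real ^ 3"
    and k0 :: nat
  assumes "0 < k1" and "0 < k2" and "0 < Tc"
    and "\<rho>L \<le> \<rho>U"
    and "0 < \<gamma>" and "\<gamma> < 1"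
    and "symmetric_matrix P" and "positive_definite P"
    and "\<forall>r\<in>{\<rho>L..\<rho>U}. transpose (A_d k1 k2 Tc r) ** P ** A_d k1 k2 Tc r \<preceq>\<^sub>L \<gamma>\<^sup>2 *\<^sub>R P"
    and "\<forall>k\<ge>k0. \<rho> k \<in> {\<rho>L..\<rho>U}"
    and "\<forall>k\<ge>k0. \<xi> (Suc k) = A_d k1 k2 Tc (\<rho> k) *v \<xi> k + g k *\<^sub>R B_d"
  shows "(\<forall>k\<ge>k0. weighted_norm P (\<xi> k) \<le>
              \<gamma> ^ (k - k0) * weighted_norm P (\<xi> k0)
              + weighted_norm P B_d * (\<Sum>j=k0..<k. \<gamma> ^ (k - 1 - j) * \<bar>g j\<bar>))
       \<and> (\<forall>gbar. (\<forall>k\<ge>k0. \<bar>g k\<bar> \<le> gbar) \<longrightarrow>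
              limsup (\<lambda>k. ereal (norm (\<xi> k)))
              \<le> ereal (sqrt (B_d \<bullet> (P *v B_d)) / (sqrt (lambda_min P) * (1 - \<gamma>)) * gbar))"
proof (intro conjI allI impI)
  have sym: "symmetric_matrix P" and pd: "positive_definite P" and \<gamma>: "0 < \<gamma>" "\<gamma> < 1"
    using assms by auto
  note psd = positive_definite_imp_semidefinite[OF pd]
  define b where "b = weighted_norm P B_d"
  have step: "weighted_norm P (\<xi> (Suc k)) \<le> \<gamma> * weighted_norm P (\<xi> k) + b * \<bar>g k\<bar>"
    if "k0 \<le> k" for k
  proof -
    let ?A = "A_d k1 k2 Tc (\<rho> k)"
    have "transpose ?A ** P ** ?A \<preceq>\<^sub>L \<gamma>\<^sup>2 *\<^sub>R P" using assms that by blast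
    then have "weighted_norm P (?A *v \<xi> k) \<le> \<gamma> * weighted_norm P (\<xi> k)"
      using \<gamma> by (intro weighted_norm_contraction) simp_all
    moreover have "\<xi> (Suc k) = ?A *v \<xi> k + g k *\<^sub>R B_d" using assms that by blast
    moreover have "weighted_norm P (g k *\<^sub>R B_d) = b * \<bar>g k\<bar>"
      by (simp add: weighted_norm_scaleR b_def)
    ultimately show ?thesis
      using weighted_norm_triangle[OF sym psd, of "?A *v \<xi> k" "g k *\<^sub>R B_d"] by simp
  qed
  have bound: "weighted_norm P (\<xi> k) \<le> \<gamma> ^ (k - k0) * weighted_norm P (\<xi> k0)
      + b * (\<Sum>j=k0..<k. \<gamma> ^ (k - 1 - j) * \<bar>g j\<bar>)" if "k0 \<le> k" for k
    using \<gamma> step that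
    by (intro linear_recurrence_convolution_bound[where w = "\<lambda>k. weighted_norm P (\<xi> k)"])
      simp_all
  show "weighted_norm P (\<xi> k) \<le> \<gamma> ^ (k - k0) * weighted_norm P (\<xi> k0)
      + weighted_norm P B_d * (\<Sum>j=k0..<k. \<gamma> ^ (k - 1 - j) * \<bar>g j\<bar>)" if "k0 \<le> k" for k
    using bound[OF that] unfolding b_def .
  fix gbar assume g: "\<forall>k\<ge>k0. \<bar>g k\<bar> \<le> gbar"
  \<comment> \<open>The bound at index \<open>k0\<close> already forces this.\<close>
  then have "0 \<le> gbar" by (meson abs_ge_zero order_refl order_trans)
  let ?s = "sqrt (lambda_min P)"
  have s: "0 < ?s" using lambda_min_pos[OF sym pd] by simp
  \<comment> \<open>The transient is separated from a term independent of \<open>k\<close>, which is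
    the claimed limsup bound.\<close>
  have "norm (\<xi> k) \<le> \<gamma> ^ (k - k0) * (weighted_norm P (\<xi> k0) / ?s)
      + b / (?s * (1 - \<gamma>)) * gbar" if "k0 \<le> k" for k
  proof -
    have "norm (\<xi> k) \<le> weighted_norm P (\<xi> k) / ?s" by (rule norm_le_weighted_norm[OF sym pd])
    also have "\<dots> \<le> (\<gamma> ^ (k - k0) * weighted_norm P (\<xi> k0) + b * (gbar / (1 - \<gamma>))) / ?s"
    proof (rule divide_right_mono)
      have "(\<Sum>j=k0..<k. \<gamma> ^ (k - 1 - j) * \<bar>g j\<bar>) \<le> gbar / (1 - \<gamma>)"
        using \<gamma> g \<open>0 \<le> gbar\<close> by (intro geometric_convolution_bound) simp_all
      then have "b * (\<Sum>j=k0..<k. \<gamma> ^ (k - 1 - j) * \<bar>g j\<bar>) \<le> b * (gbar / (1 - \<gamma>))"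
        unfolding b_def by (rule mult_left_mono) (rule weighted_norm_nonneg[OF psd])
      then show "weighted_norm P (\<xi> k)
          \<le> \<gamma> ^ (k - k0) * weighted_norm P (\<xi> k0) + b * (gbar / (1 - \<gamma>))"
        using bound[OF that] by linarith
    qed (use s in simp)
    finally show ?thesis by (simp add: add_divide_distrib mult.commute)
  qed
  then have "limsup (\<lambda>k. ereal (norm (\<xi> k))) \<le> ereal (b / (?s * (1 - \<gamma>)) * gbar)"
    using \<gamma> by (intro limsup_le_geometric_offset[OF less_imp_le])
  then show "limsup (\<lambda>k. ereal (norm (\<xi> k)))
      \<le> ereal (sqrt (B_d \<bullet> (P *v B_d)) / (?s * (1 - \<gamma>)) * gbar)"
    unfolding b_def weighted_norm_def .
qed

end
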